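(* Let $G$ be a simple graph on $n$ vertices, and suppose $G$ has an induced (chordless) cycle of length at least $4$; let $m$ be the smallest length of such a cycle. A $G$-partial matrix $\pi_G(a_{ij})$ has a positive definite completion if and only if (a) every completely specified principal submatrix is positive definite, and (b) $\pi_G(a_{ij})$ can be completed to a positive semidefinite matrix of rank greater than $n-m+2$. If $G$ is chordal (has no induced cycle of length $\geq 4$), then a $G$-partial matrix has a positive definite completion if and only if (a) holds.
   Context: A $G$-partial matrix is the data $\pi_G(A)=((a_{ii})_{i\in[n]},(a_{ij})_{\{i,j\}\in E})$ of a real symmetric $n\times n$ matrix $A$ restricted to its diagonal and entries indexed by edges of $G=([n],E)$; a completion is any real symmetric matrix with these specified entries. The completely specified principal submatrices are the principal submatrices indexed by cliques of $G$. *)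

theory Defs
  imports "HOL-Analysis.Analysis"
begin

text \<open>Simple graphs on a finite vertex type 'n (vertex set [n] with n = CARD('n)),
  given by a symmetric irreflexive adjacency relation.\<close>

definition simple_graph :: "('n \<Rightarrow> 'n \<Rightarrow> bool) \<Rightarrow> bool" where
  "simple_graph E \<longleftrightarrow> (\<forall>i j. E i j \<longrightarrow> E j i) \<and> (\<forall>i. \<not> E i i)"

definition induced_cycle :: "('n \<Rightarrow> 'n \<Rightarrow> bool) \<Rightarrow> 'n list \<Rightarrow> bool" where
  "induced_cycle E vs \<longleftrightarrow> length vs \<ge> 3 \<and> distinct vs \<and>
     (\<forall>i<length vs. \<forall>j<length vs.
        E (vs ! i) (vs ! j) \<longleftrightarrow> (j = (i + 1) mod length vs \<or> i = (j + 1) mod length vs))"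

definition chordal :: "('n \<Rightarrow> 'n \<Rightarrow> bool) \<Rightarrow> bool" where
  "chordal E \<longleftrightarrow> \<not> (\<exists>vs. induced_cycle E vs \<and> length vs \<ge> 4)"

definition min_long_induced_cycle :: "('n \<Rightarrow> 'n \<Rightarrow> bool) \<Rightarrow> nat" where
  "min_long_induced_cycle E = (LEAST k. \<exists>vs. induced_cycle E vs \<and> length vs = k \<and> k \<ge> 4)"

definition clique :: "('n \<Rightarrow> 'n \<Rightarrow> bool) \<Rightarrow> 'n set \<Rightarrow> bool" where
  "clique E C \<longleftrightarrow> (\<forall>i\<in>C. \<forall>j\<in>C. i \<noteq> j \<longrightarrow> E i j)"

definition symmetric_mat :: "real^'n^'n \<Rightarrow> bool" where
  "symmetric_mat A \<longleftrightarrow> transpose A = A"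

definition pos_def :: "real^'n^'n \<Rightarrow> bool" where
  "pos_def A \<longleftrightarrow> symmetric_mat A \<and> (\<forall>x. x \<noteq> 0 \<longrightarrow> x \<bullet> (A *v x) > 0)"

definition pos_semidef :: "real^'n^'n \<Rightarrow> bool" where
  "pos_semidef A \<longleftrightarrow> symmetric_mat A \<and> (\<forall>x. x \<bullet> (A *v x) \<ge> 0)"

text \<open>The principal submatrix A[C] (indexed by C) is positive definite:
  its quadratic form, i.e. the quadratic form of A on vectors supported in C, is positive
  on nonzero vectors.\<close>

definition principal_submatrix_pos_def :: "real^'n^'n \<Rightarrow> 'n set \<Rightarrow> bool" where
  "principal_submatrix_pos_def A C \<longleftrightarrow>
     (\<forall>i\<in>C. \<forall>j\<in>C. A $ i $ j = A $ j $ i) \<and>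
     (\<forall>x. x \<noteq> 0 \<and> (\<forall>i. i \<notin> C \<longrightarrow> x $ i = 0) \<longrightarrow> x \<bullet> (A *v x) > 0)"

text \<open>B is a completion of the G-partial matrix pi_G(A): B is real symmetric and agrees
  with A on the diagonal and on the entries indexed by edges.\<close>

definition completion :: "('n \<Rightarrow> 'n \<Rightarrow> bool) \<Rightarrow> real^'n^'n \<Rightarrow> real^'n^'n \<Rightarrow> bool" where
  "completion E A B \<longleftrightarrow> symmetric_mat B \<and> (\<forall>i. B $ i $ i = A $ i $ i) \<and>
     (\<forall>i j. E i j \<longrightarrow> B $ i $ j = A $ i $ j)"

end

theory Submission
  imports Defs
begin

text \<open>
  By separation, a partial matrix without positive definite completion admits a nonzero positive
  semidefinite \<open>Y\<close> that vanishes off the pattern of the graph and satisfies \<open>Y \<bullet> A \<le> 0\<close>. The heart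
  of the argument is that a positive semidefinite \<open>X\<close> with the sparsity pattern of \<open>E\<close> is a sum of
  matrices \<open>y y\<^sup>T\<close> with clique-supported \<open>y\<close> whenever \<open>E\<close> has no induced cycle of length between
  \<open>4\<close> and \<open>rank X + 2\<close>; for \<open>Y\<close> this contradicts (a).

  The decomposition is by induction on the rank. If the column space of \<open>X\<close> contains a nonzero
  clique-supported vector, subtracting a multiple of its square lowers the rank. Otherwise pick \<open>a\<close>
  with \<open>X\<^sub>a\<^sub>a > 0\<close> and take the Schur complement at \<open>a\<close>. Its pattern is the graph with \<open>a\<close> eliminated
  (its neighbourhood made a clique), in which an induced cycle is at most one shorter than one of \<open>E\<close>.
  So it is a sum of squares supported on cliques of the new graph; none of these is a clique of \<open>E\<close>,
  and as \<open>E\<close> has no induced 4-cycle they all lie in the neighbourhood of \<open>a\<close>. Hence \<open>X\<close> lives on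
  \<open>a\<close> and its neighbours, for every such \<open>a\<close>, so its support is a clique after all.

  If \<open>B\<close> is a positive semidefinite completion, then \<open>Y \<bullet> B \<le> 0\<close> forces \<open>B Y = 0\<close>, so the rank
  hypothesis (b) on \<open>B\<close> bounds the rank of \<open>Y\<close> by \<open>m - 3\<close>.
\<close>

section \<open>Induced cycles and vertex elimination\<close>

lemma induced_cycle_rotate1:
  assumes "induced_cycle E vs"
  shows "induced_cycle E (rotate1 vs)"
proof -
  let ?k = "length vs"
  have k: "?k \<ge> 3" using assms by (simp add: induced_cycle_def)
  have E: "E (vs ! i) (vs ! j) \<longleftrightarrow> (j = (i + 1) mod ?k \<or> i = (j + 1) mod ?k)"
    if "i < ?k" "j < ?k" for i j
    using assms that by (auto simp: induced_cycle_def)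
  have nth: "rotate1 vs ! i = vs ! ((i + 1) mod ?k)" if "i < ?k" for i
    using that nth_rotate1[of i vs] by simp
  have step: "(j + 1) mod ?k = ((i + 1) mod ?k + 1) mod ?k \<longleftrightarrow> j = (i + 1) mod ?k"
    if "i < ?k" "j < ?k" for i j
    using that k by (auto simp: mod_Suc)
  have "E (rotate1 vs ! i) (rotate1 vs ! j) \<longleftrightarrow> (j = (i + 1) mod ?k \<or> i = (j + 1) mod ?k)"
    if "i < ?k" "j < ?k" for i j
  proof -
    have "(i + 1) mod ?k < ?k" "(j + 1) mod ?k < ?k" using k by (auto intro!: mod_less_divisor)
    then show ?thesis using E[of "(i + 1) mod ?k" "(j + 1) mod ?k"] nth that step by metis
  qed
  then show ?thesis using assms by (simp add: induced_cycle_def)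
qed

lemma induced_cycle_rotate: "induced_cycle E vs \<Longrightarrow> induced_cycle E (rotate n vs)"
  by (induction n) (auto simp: induced_cycle_rotate1)

lemma cyclic_successor_cases:
  fixes i j k :: nat
  assumes "i < j" "j < k"
  shows "(j = (i + 1) mod k \<or> i = (j + 1) mod k) \<longleftrightarrow> (j = i + 1 \<or> (i = 0 \<and> j = k - 1))"
  using assms by (auto simp: mod_Suc)

text \<open>Symmetry leaves only pairs \<open>i < j\<close>, where the sole wrap-around edge joins
  first and last position. Without \<open>mod\<close>, prepending a vertex is a plain index
  shift.\<close>

lemma induced_cycle_iff_linear:
  assumes "simple_graph E"
  shows "induced_cycle E vs \<longleftrightarrow> length vs \<ge> 3 \<and> distinct vs \<and>
     (\<forall>j<length vs. \<forall>i<j. E (vs ! i) (vs ! j) \<longleftrightarrow> (j = i + 1 \<or> (i = 0 \<and> j = length vs - 1)))"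
    (is "_ \<longleftrightarrow> ?R")
proof
  assume c: "induced_cycle E vs"
  have "E (vs ! i) (vs ! j) \<longleftrightarrow> (j = i + 1 \<or> (i = 0 \<and> j = length vs - 1))"
    if "i < j" "j < length vs" for i j
  proof -
    have "E (vs ! i) (vs ! j) \<longleftrightarrow> (j = (i + 1) mod length vs \<or> i = (j + 1) mod length vs)"
      using c that order.strict_trans[OF that] unfolding induced_cycle_def by blast
    then show ?thesis using cyclic_successor_cases[OF that] by simp
  qed
  then show ?R using c by (simp add: induced_cycle_def)
next
  assume r: ?R
  have lt: "E (vs ! i) (vs ! j) \<longleftrightarrow> (j = (i + 1) mod length vs \<or> i = (j + 1) mod length vs)"
    if "i < j" "j < length vs" for i j
    using r that cyclic_successor_cases[OF that] by simp
  have "E (vs ! i) (vs ! j) \<longleftrightarrow> (j = (i + 1) mod length vs \<or> i = (j + 1) mod length vs)"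
    if ij: "i < length vs" "j < length vs" for i j
  proof (cases i j rule: linorder_cases)
    case less
    then show ?thesis using lt ij by simp
  next
    case equal
    then show ?thesis using assms r ij by (auto simp: simple_graph_def mod_Suc)
  next
    case greater
    then have "E (vs ! i) (vs ! j) \<longleftrightarrow> E (vs ! j) (vs ! i)"
      using assms by (auto simp: simple_graph_def)
    then show ?thesis using lt[OF greater] ij by blast
  qed
  then show "induced_cycle E vs" using r by (simp add: induced_cycle_def)
qed

lemma induced_four_cycle:
  assumes "simple_graph E" "distinct [a, b, c, d]"
    and "E a b" "E b c" "E c d" "E d a" "\<not> E a c" "\<not> E b d"
  shows "induced_cycle E [a, b, c, d]"
proof -
  have "E a d" using assms(1,6) by (auto simp: simple_graph_def)
  then show ?thesis
    using assms unfolding induced_cycle_iff_linear[OF assms(1)]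
    by (auto simp: less_Suc_eq numeral_eq_Suc)
qed

text \<open>The fill-in graph of Gaussian elimination at \<open>a\<close>. The vertex
  \<open>a\<close> is isolated rather than deleted, so the vertex type stays fixed.\<close>

definition eliminate :: "('n \<Rightarrow> 'n \<Rightarrow> bool) \<Rightarrow> 'n \<Rightarrow> 'n \<Rightarrow> 'n \<Rightarrow> bool" where
  "eliminate E a i j \<longleftrightarrow> i \<noteq> j \<and> i \<noteq> a \<and> j \<noteq> a \<and> (E i j \<or> E a i \<and> E a j)"

lemma simple_graph_eliminate: "simple_graph E \<Longrightarrow> simple_graph (eliminate E a)"
  by (auto simp: simple_graph_def eliminate_def)

text \<open>A cycle of old edges is already induced in \<open>E\<close>. Otherwise some edge is fill
  between two neighbours of \<open>a\<close>, and routing through \<open>a\<close> instead lengthens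
  the cycle by one.\<close>

lemma induced_cycle_eliminate:
  assumes sg: "simple_graph E" and c: "induced_cycle (eliminate E a) vs" and k4: "length vs \<ge> 4"
  shows "\<exists>ws. induced_cycle E ws \<and> length vs \<le> length ws \<and> length ws \<le> length vs + 1"
proof -
  let ?F = "eliminate E a" and ?k = "length vs"
  have sF: "simple_graph ?F" by (rule simple_graph_eliminate[OF sg])
  have na: "vs ! i \<noteq> a" if "i < ?k" for i
  proof -
    have "(i + 1) mod ?k < ?k" using k4 by (auto intro!: mod_less_divisor)
    then have "?F (vs ! i) (vs ! ((i + 1) mod ?k))"
      using c that by (auto simp: induced_cycle_def)
    then show ?thesis by (simp add: eliminate_def)
  qed
  show ?thesis
  proof (cases "\<forall>i<?k. \<forall>j<?k. ?F (vs ! i) (vs ! j) \<longrightarrow> E (vs ! i) (vs ! j)")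
    case True
    have "E (vs ! i) (vs ! j) \<longleftrightarrow> ?F (vs ! i) (vs ! j)" if "i < ?k" "j < ?k" for i j
      using True that na sg by (auto simp: eliminate_def simple_graph_def)
    then have "induced_cycle E vs" using c by (auto simp: induced_cycle_def)
    then show ?thesis by auto
  next
    case False
    then obtain p q where pq: "p < ?k" "q < ?k" "?F (vs ! p) (vs ! q)" "\<not> E (vs ! p) (vs ! q)"
      by blast
    then have "q = (p + 1) mod ?k \<or> p = (q + 1) mod ?k"
      using c by (auto simp: induced_cycle_def)
    moreover have "?F (vs ! q) (vs ! p)" "\<not> E (vs ! q) (vs ! p)"
      using pq sg sF by (auto simp: simple_graph_def)
    ultimately obtain i where i: "i < ?k" "?F (vs ! i) (vs ! ((i + 1) mod ?k))"
      "\<not> E (vs ! i) (vs ! ((i + 1) mod ?k))"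
      using pq by blast
    \<comment> \<open>The rotation makes the fill edge the one from last to first position.\<close>
    define ws where "ws = rotate (i + 1) vs"
    have len: "length ws = ?k" by (simp add: ws_def)
    have w0: "ws ! 0 = vs ! ((i + 1) mod ?k)"
      unfolding ws_def using k4 by (subst nth_rotate) auto
    have "i + 1 + (?k - 1) = i + ?k" using k4 by simp
    then have "(i + 1 + (?k - 1)) mod ?k = i" using i(1) by simp
    then have wl: "ws ! (?k - 1) = vs ! i"
      unfolding ws_def using k4 by (subst nth_rotate) auto
    have cw: "induced_cycle ?F ws"
      unfolding ws_def by (rule induced_cycle_rotate[OF c])
    then have dw: "distinct ws"
      and F: "\<And>i j. i < j \<Longrightarrow> j < ?k \<Longrightarrow>
                ?F (ws ! i) (ws ! j) \<longleftrightarrow> (j = i + 1 \<or> (i = 0 \<and> j = ?k - 1))"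
      using induced_cycle_iff_linear[OF sF, of ws] len by auto
    have aw: "a \<notin> set ws" using na by (auto simp: ws_def in_set_conv_nth)
    have ends: "E a (ws ! 0)" "E a (ws ! (?k - 1))" "\<not> E (ws ! 0) (ws ! (?k - 1))"
      using i w0 wl sg by (auto simp: eliminate_def simple_graph_def)
    have inner: "\<not> E a (ws ! l)" if "0 < l" "l < ?k - 1" for l
    proof
      assume El: "E a (ws ! l)"
      have lk: "l < ?k" "0 < ?k" "?k - 1 < ?k" using that by linarith+
      have d: "ws ! 0 \<noteq> ws ! l" "ws ! l \<noteq> ws ! (?k - 1)"
        using that len lk nth_eq_iff_index_eq[OF dw, of 0 l]
          nth_eq_iff_index_eq[OF dw, of l "?k - 1"] by presburger+
      have "ws ! l \<in> set ws" "ws ! 0 \<in> set ws" "ws ! (?k - 1) \<in> set ws"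
        using that len by (auto intro!: nth_mem)
      then have "a \<noteq> ws ! l" "a \<noteq> ws ! 0" "a \<noteq> ws ! (?k - 1)"
        using aw by auto
      then have "?F (ws ! 0) (ws ! l)" "?F (ws ! l) (ws ! (?k - 1))"
        using d El ends by (auto simp: eliminate_def)
      \<comment> \<open>A third neighbour of \<open>a\<close> would be adjacent to both ends of the
        fill edge, forcing a triangle.\<close>
      then have "l = 1" "?k - 1 = l + 1" using F[of 0 l] F[of l "?k - 1"] that by auto
      then show False using k4 by simp
    qed
    have Ew: "E (ws ! i) (ws ! j) \<longleftrightarrow> j = i + 1" if ij: "i < j" "j < ?k" for i j
    proof -
      have d: "ws ! i \<noteq> ws ! j" using dw ij len by (simp add: nth_eq_iff_index_eq)
      have "a \<noteq> ws ! i" "a \<noteq> ws ! j" using aw len ij by auto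
      then have eq: "?F (ws ! i) (ws ! j) \<longleftrightarrow> E (ws ! i) (ws ! j) \<or> E a (ws ! i) \<and> E a (ws ! j)"
        using d by (auto simp: eliminate_def)
      show ?thesis
      proof (cases "i = 0 \<and> j = ?k - 1")
        case True
        then show ?thesis using ends k4 by simp
      next
        case False
        \<comment> \<open>Any other pair has an interior vertex, which is no neighbour of
          \<open>a\<close>, so it cannot be joined by fill.\<close>
        then have "0 < i \<and> i < ?k - 1 \<or> 0 < j \<and> j < ?k - 1" using ij by auto
        then have "\<not> (E a (ws ! i) \<and> E a (ws ! j))" using inner by blast
        then show ?thesis using eq F[OF ij] False by auto
      qed
    qed
    have "E ((a # ws) ! i) ((a # ws) ! j) \<longleftrightarrow> (j = i + 1 \<or> (i = 0 \<and> j = length (a # ws) - 1))"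
      if "i < j" "j < length (a # ws)" for i j
    proof (cases i)
      case 0
      then show ?thesis using that ends inner[of "j - 1"] len
        by (cases "j = 1"; cases "j = ?k") auto
    next
      case (Suc i')
      then show ?thesis using that Ew[of i' "j - 1"] len by auto
    qed
    then have "induced_cycle E (a # ws)"
      using dw aw len k4 by (subst induced_cycle_iff_linear[OF sg]) auto
    then show ?thesis using len by (intro exI[of _ "a # ws"]) auto
  qed
qed

text \<open>A pair \<open>b\<close>, \<open>c\<close> of \<open>K\<close> not adjacent in
  \<open>E\<close> is joined by fill, so both are neighbours of \<open>a\<close>. A vertex
  \<open>d\<close> of \<open>K\<close> not adjacent to \<open>a\<close> has old edges to both, and
  \<open>a\<close>, \<open>b\<close>, \<open>d\<close>, \<open>c\<close> is an induced
  four-cycle.\<close>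

lemma clique_eliminate:
  assumes sg: "simple_graph E" and no4: "\<not> (\<exists>vs. induced_cycle E vs \<and> length vs = 4)"
    and K: "clique (eliminate E a) K" and nK: "\<not> clique E K" and d: "d \<in> K"
  shows "E a d"
proof -
  obtain b c where bc: "b \<in> K" "c \<in> K" "b \<noteq> c" "\<not> E b c"
    using nK by (auto simp: clique_def)
  then have "eliminate E a b c" using K by (auto simp: clique_def)
  then have ab: "E a b" "E a c" "a \<noteq> b" "a \<noteq> c" using bc by (auto simp: eliminate_def)
  show ?thesis
  proof (rule ccontr)
    assume n: "\<not> E a d"
    then have db: "d \<noteq> b" "d \<noteq> c" using ab by auto
    then have "eliminate E a d b" "eliminate E a d c" using K bc d by (auto simp: clique_def)
    then have "d \<noteq> a" "E d b" "E d c" using n by (auto simp: eliminate_def)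
    then have "induced_cycle E [a, b, d, c]"
      using ab db bc n sg by (intro induced_four_cycle) (auto simp: simple_graph_def)
    then show False using no4 by fastforce
  qed
qed

section \<open>Positive semidefinite matrices\<close>

definition outer :: "real^'n \<Rightarrow> real^'n^'n" where
  "outer y = (\<chi> i j. y $ i * y $ j)"

lemma outer_nth [simp]: "outer y $ i $ j = y $ i * y $ j"
  by (simp add: outer_def)

lemma outer_zero [simp]: "outer 0 = 0"
  by (simp add: vec_eq_iff)

lemma outer_mult_vec: "outer y *v x = (y \<bullet> x) *\<^sub>R y"
  by (simp add: vec_eq_iff matrix_vector_mult_def inner_vec_def sum_distrib_left sum_distrib_right
      mult_ac)

lemma inner_outer: "outer y \<bullet> B = y \<bullet> (B *v y)"
  by (simp add: inner_vec_def matrix_vector_mult_def sum_distrib_left mult_ac)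

lemma symmetric_mat_nth: "symmetric_mat X \<longleftrightarrow> (\<forall>i j. X $ i $ j = X $ j $ i)"
  by (auto simp: symmetric_mat_def vec_eq_iff transpose_def)

lemma symmetric_mat_inner: "symmetric_mat X \<Longrightarrow> x \<bullet> (X *v y) = (X *v x) \<bullet> y"
  by (metis dot_lmul_matrix symmetric_mat_def transpose_matrix_vector)

lemma pos_semidefD:
  assumes "pos_semidef X"
  shows "symmetric_mat X" "x \<bullet> (X *v x) \<ge> 0"
  using assms by (auto simp: pos_semidef_def)

lemma pos_semidef_quadratic:
  assumes "pos_semidef X"
  shows "0 \<le> x \<bullet> (X *v x) + 2 * t * (x \<bullet> (X *v z)) + t^2 * (z \<bullet> (X *v z))"
proof -
  have "0 \<le> (x + t *\<^sub>R z) \<bullet> (X *v (x + t *\<^sub>R z))"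
    using assms by (rule pos_semidefD)
  also have "\<dots> = x \<bullet> (X *v x) + 2 * t * (x \<bullet> (X *v z)) + t^2 * (z \<bullet> (X *v z))"
    using symmetric_mat_inner[OF pos_semidefD(1)[OF assms], of x z]
    by (simp add: algebra_simps inner_add_left inner_add_right matrix_vector_mult_scaleR
        power2_eq_square inner_commute)
  finally show ?thesis .
qed

lemma pos_semidef_Cauchy_Schwarz:
  assumes "pos_semidef X" "z \<bullet> (X *v z) > 0"
  shows "(x \<bullet> (X *v z))^2 / (z \<bullet> (X *v z)) \<le> x \<bullet> (X *v x)"
proof -
  have "0 \<le> x \<bullet> (X *v x) + 2 * (- (x \<bullet> (X *v z)) / (z \<bullet> (X *v z))) * (x \<bullet> (X *v z))
      + (- (x \<bullet> (X *v z)) / (z \<bullet> (X *v z)))^2 * (z \<bullet> (X *v z))"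
    by (rule pos_semidef_quadratic[OF assms(1)])
  then show ?thesis using assms(2) by (simp add: field_simps power2_eq_square)
qed

text \<open>With \<open>w = X *v z\<close>, either the form vanishes at \<open>w\<close> and is
  negative at \<open>z - w\<close>, or Cauchy-Schwarz against \<open>w\<close> makes it positive at
  \<open>z\<close>.\<close>

lemma pos_semidef_kernel:
  assumes "pos_semidef X" "z \<bullet> (X *v z) = 0"
  shows "X *v z = 0"
proof (rule ccontr)
  assume nz: "X *v z \<noteq> 0"
  define w where "w = X *v z"
  have w: "w \<bullet> (X *v z) > 0" using nz by (simp add: w_def)
  have wz: "z \<bullet> (X *v w) = w \<bullet> (X *v z)"
    using symmetric_mat_inner[OF pos_semidefD(1)[OF assms(1)], of z w] by (simp add: inner_commute)
  show False
  proof (cases "w \<bullet> (X *v w) = 0")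
    case True
    then show False using pos_semidef_quadratic[OF assms(1), of z "-1" w] assms(2) w wz by simp
  next
    case False
    then have pos: "w \<bullet> (X *v w) > 0" using pos_semidefD(2)[OF assms(1), of w] by simp
    have "(z \<bullet> (X *v w))^2 / (w \<bullet> (X *v w)) > 0" using pos w wz by simp
    then show False using pos_semidef_Cauchy_Schwarz[OF assms(1) pos, of z] assms(2) by simp
  qed
qed

text \<open>Wedderburn's rank-one reduction. For \<open>z = axis a 1\<close> it is the Schur
  complement at \<open>a\<close>, bordered by a zero row and column.\<close>

definition deflate :: "real^'n^'n \<Rightarrow> real^'n \<Rightarrow> real^'n^'n" where
  "deflate X z = X - (1 / (z \<bullet> (X *v z))) *\<^sub>R outer (X *v z)"

lemma deflate_mult_vec:
  "deflate X z *v x = X *v x - ((X *v z) \<bullet> x / (z \<bullet> (X *v z))) *\<^sub>R (X *v z)"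
  by (simp add: deflate_def algebra_simps outer_mult_vec scaleR_matrix_vector_assoc[symmetric])

lemma pos_semidef_deflate:
  assumes "pos_semidef X" "z \<bullet> (X *v z) > 0"
  shows "pos_semidef (deflate X z)"
proof -
  have "symmetric_mat (deflate X z)"
    using pos_semidefD(1)[OF assms(1)] by (simp add: symmetric_mat_nth deflate_def mult.commute)
  moreover have "x \<bullet> (deflate X z *v x) \<ge> 0" for x
    using pos_semidef_Cauchy_Schwarz[OF assms, of x]
    by (simp add: deflate_mult_vec inner_diff_right inner_commute power2_eq_square)
  ultimately show ?thesis by (simp add: pos_semidef_def)
qed

text \<open>The new range lies in the old one and is orthogonal to \<open>z\<close>, whereas
  \<open>X *v z\<close> is in the old range and not orthogonal to \<open>z\<close>.\<close>

lemma rank_deflate: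
  assumes "symmetric_mat X" "z \<bullet> (X *v z) > 0"
  shows "rank (deflate X z) < rank X"
proof -
  let ?X' = "deflate X z"
  have sub: "range ((*v) ?X') \<subseteq> range ((*v) X)"
  proof clarify
    fix x
    have "?X' *v x = X *v (x - ((X *v z) \<bullet> x / (z \<bullet> (X *v z))) *\<^sub>R z)"
      by (simp add: deflate_mult_vec algebra_simps matrix_vector_mult_scaleR)
    then show "?X' *v x \<in> range ((*v) X)" by blast
  qed
  have orth: "z \<bullet> (?X' *v x) = 0" for x
    using assms symmetric_mat_inner[OF assms(1), of z x]
    by (simp add: deflate_mult_vec inner_diff_right)
  have "X *v z \<notin> range ((*v) ?X')" using orth assms(2) by fastforce
  then have "range ((*v) ?X') \<subset> range ((*v) X)" using sub by blast
  then have "span (range ((*v) ?X')) \<subset> span (range ((*v) X))"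
    by (simp add: span_eq_iff[THEN iffD2] linear_subspace_image)
  then show ?thesis unfolding rank_dim_range by (rule dim_psubset)
qed

text \<open>By symmetry of \<open>B\<close>, the range of \<open>Y\<close> lies in the orthogonal
  complement of the range of \<open>B\<close>.\<close>

lemma rank_add_le_of_product_zero:
  fixes B Y :: "real^'n^'n"
  assumes "symmetric_mat B" "\<And>x. B *v (Y *v x) = 0"
  shows "rank Y + rank B \<le> CARD('n)"
proof -
  let ?S = "range ((*v) B)"
  have s: "subspace ?S" by (simp add: linear_subspace_image)
  have "range ((*v) Y) \<subseteq> {y \<in> UNIV. \<forall>x \<in> ?S. orthogonal x y}"
    using assms symmetric_mat_inner[OF assms(1)] by (auto simp: orthogonal_def simp flip: symmetric_mat_inner)
  then have "dim (range ((*v) Y)) \<le> dim {y \<in> UNIV. \<forall>x \<in> ?S. orthogonal x y}"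
    by (rule dim_subset)
  moreover have "dim {y \<in> (UNIV::(real^'n) set). \<forall>x \<in> ?S. orthogonal x y} + dim ?S = dim (UNIV::(real^'n) set)"
    by (rule dim_subspace_orthogonal_to_vectors[OF s]) auto
  ultimately show ?thesis by (simp add: rank_dim_range)
qed

section \<open>Sums of clique-supported squares\<close>

inductive clique_sum :: "('n \<Rightarrow> 'n \<Rightarrow> bool) \<Rightarrow> real^'n^'n \<Rightarrow> bool" for E where
  zero: "clique_sum E 0"
| add: "clique_sum E X \<Longrightarrow> clique E {i. y $ i \<noteq> 0} \<Longrightarrow> clique_sum E (X + outer y)"

lemma clique_sum_pos_semidef: "clique_sum E X \<Longrightarrow> pos_semidef X"
proof (induction rule: clique_sum.induct)
  case zero
  then show ?case by (simp add: pos_semidef_def symmetric_mat_nth)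
next
  case (add X y)
  then show ?case
    by (simp add: pos_semidef_def symmetric_mat_nth mult.commute algebra_simps outer_mult_vec
        inner_commute inner_add_right)
qed

text \<open>The component \<open>q\<close> of \<open>y\<close> orthogonal to the range is in the
  kernel, so \<open>q\<close> is orthogonal to \<open>y\<close> and hence to itself.\<close>

lemma in_range_symmetric_mat:
  assumes "symmetric_mat X" "\<And>z. X *v z = 0 \<Longrightarrow> y \<bullet> z = 0"
  shows "y \<in> range ((*v) X)"
proof -
  have sub: "span (range ((*v) X)) = range ((*v) X)"
    by (simp add: span_eq_iff linear_subspace_image)
  obtain p q where pq: "p \<in> span (range ((*v) X))"
    "\<And>w. w \<in> span (range ((*v) X)) \<Longrightarrow> orthogonal q w" "y = p + q"
    using orthogonal_subspace_decomp_exists[of "range ((*v) X)" y] by metis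
  have "(X *v q) \<bullet> w = 0" for w
    using pq(2)[of "X *v w"] symmetric_mat_inner[OF assms(1), of q w] sub
    by (simp add: orthogonal_def)
  then have "X *v q = 0" using inner_eq_zero_iff by blast
  then have "y \<bullet> q = 0" by (rule assms(2))
  moreover have "p \<bullet> q = 0" using pq(1,2) by (simp add: orthogonal_def inner_commute)
  ultimately have "q = 0" using pq(3) by (simp add: inner_add_left)
  then show ?thesis using pq sub by simp
qed

lemma clique_sum_diagonal:
  assumes "clique_sum E X" "X $ i $ i \<noteq> 0"
  shows "\<exists>y \<in> range ((*v) X). y $ i \<noteq> 0 \<and> clique E {j. y $ j \<noteq> 0}"
proof -
  \<comment> \<open>Orthogonality to the kernel replaces range membership because it survives adding
    a square: positive semidefinite terms cannot cancel, so the kernel only shrinks.\<close>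
  have "\<exists>y. y $ i \<noteq> 0 \<and> clique E {j. y $ j \<noteq> 0} \<and> (\<forall>z. X *v z = 0 \<longrightarrow> y \<bullet> z = 0)"
    using assms
  proof (induction rule: clique_sum.induct)
    case zero
    then show ?case by simp
  next
    case (add X y)
    have ker: "X *v z = 0" "y \<bullet> z = 0" if "(X + outer y) *v z = 0" for z
    proof -
      have psd: "pos_semidef X" using add.hyps(1) by (rule clique_sum_pos_semidef)
      have "z \<bullet> (X *v z) + (y \<bullet> z)^2 = z \<bullet> ((X + outer y) *v z)"
        by (simp add: algebra_simps outer_mult_vec inner_add_right inner_commute power2_eq_square)
      then have "z \<bullet> (X *v z) + (y \<bullet> z)^2 = 0" using that by simp
      then have "z \<bullet> (X *v z) = 0" "(y \<bullet> z)^2 = 0"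
        using pos_semidefD(2)[OF psd, of z] zero_le_power2[of "y \<bullet> z"] by linarith+
      then show "X *v z = 0" "y \<bullet> z = 0" using pos_semidef_kernel[OF psd] by auto
    qed
    show ?case
    proof (cases "y $ i = 0")
      case True
      then show ?thesis using add ker by auto
    next
      case False
      then show ?thesis using add.hyps(2) ker by blast
    qed
  qed
  then show ?thesis
    using in_range_symmetric_mat pos_semidefD(1)[OF clique_sum_pos_semidef[OF assms(1)]] by blast
qed

lemma clique_sum_add_scaled:
  assumes "clique_sum E X" "clique E {i. y $ i \<noteq> 0}" "c \<ge> 0"
  shows "clique_sum E (X + c *\<^sub>R outer y)"
proof -
  have "c *\<^sub>R outer y = outer (sqrt c *\<^sub>R y)"
    using assms(3) by (simp add: vec_eq_iff)
  moreover have "clique E {i. (sqrt c *\<^sub>R y) $ i \<noteq> 0}"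
    using assms(2) by (auto simp: clique_def)
  ultimately show ?thesis using clique_sum.add[OF assms(1)] by metis
qed

section \<open>Decomposing a sparse positive semidefinite matrix\<close>

lemma mult_axis_nth: "(X *v axis a 1) $ i = X $ i $ a" for X :: "real^'n^'m"
  by (simp add: matrix_vector_mult_basis column_def)

lemma inner_axis_mult_axis: "axis a 1 \<bullet> (X *v axis a 1) = X $ a $ a" for X :: "real^'n^'n"
  by (simp add: inner_axis' mult_axis_nth)

lemma pos_semidef_diagonal_zero:
  assumes "pos_semidef X" "X $ a $ a = 0"
  shows "X $ i $ a = 0"
  using pos_semidef_kernel[OF assms(1), of "axis a 1"] assms(2)
  by (metis inner_axis_mult_axis mult_axis_nth zero_index)

theorem sparse_pos_semidef_clique_sum:
  fixes X :: "real^'n^'n"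
  assumes "simple_graph E" "pos_semidef X" "\<And>i j. i \<noteq> j \<Longrightarrow> \<not> E i j \<Longrightarrow> X $ i $ j = 0"
    and "\<And>vs. induced_cycle E vs \<Longrightarrow> 4 \<le> length vs \<Longrightarrow> rank X + 2 < length vs"
  shows "clique_sum E X"
  using assms
proof (induction "rank X" arbitrary: X E rule: less_induct)
  case less
  note sg = less.prems(1) and psd = less.prems(2) and pat = less.prems(3) and cyc = less.prems(4)
  have sym: "symmetric_mat X" by (rule pos_semidefD(1)[OF psd])
  show ?case
  proof (cases "\<exists>z. X *v z \<noteq> 0 \<and> clique E {i. (X *v z) $ i \<noteq> 0}")
    case True
    then obtain z where z: "X *v z \<noteq> 0" "clique E {i. (X *v z) $ i \<noteq> 0}" by blast
    have pos: "z \<bullet> (X *v z) > 0"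
      using pos_semidefD(2)[OF psd, of z] pos_semidef_kernel[OF psd, of z] z(1) by force
    have rk: "rank (deflate X z) < rank X" by (rule rank_deflate[OF sym pos])
    have pat': "deflate X z $ i $ j = 0" if "i \<noteq> j" "\<not> E i j" for i j
      using pat[OF that] z(2) that by (auto simp: deflate_def clique_def)
    have "clique_sum E (deflate X z)"
    proof (rule less.hyps[OF rk sg pos_semidef_deflate[OF psd pos] pat'])
      show "rank (deflate X z) + 2 < length vs" if "induced_cycle E vs" "4 \<le> length vs" for vs
        using cyc[OF that] rk by simp
    qed
    then have "clique_sum E (deflate X z + (1 / (z \<bullet> (X *v z))) *\<^sub>R outer (X *v z))"
      using z(2) pos by (intro clique_sum_add_scaled) auto
    then show ?thesis by (simp add: deflate_def)
  next
    case False
    \<comment> \<open>If \<open>a\<close> and \<open>b\<close> were not adjacent, the Schur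
      complement at \<open>a\<close> would leave the entry at \<open>(b, b)\<close> unchanged and
      nonzero, and some summand of its decomposition would see \<open>b\<close>.\<close>
    have adj: "E a b" if a: "X $ a $ a \<noteq> 0" and b: "X $ b $ b \<noteq> 0" and ab: "a \<noteq> b" for a b
    proof (rule ccontr)
      assume nE: "\<not> E a b"
      let ?z = "axis a 1 :: real^'n"
      define X' where "X' = deflate X ?z"
      have pos: "?z \<bullet> (X *v ?z) > 0"
        using a pos_semidefD(2)[OF psd, of ?z] by (simp add: inner_axis_mult_axis)
      have rk: "rank X' < rank X" unfolding X'_def by (rule rank_deflate[OF sym pos])
      have X': "X' $ i $ j = X $ i $ j - X $ i $ a * X $ j $ a / X $ a $ a" for i j
        by (simp add: X'_def deflate_def inner_axis_mult_axis mult_axis_nth)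
      have symE: "X $ i $ j = X $ j $ i" for i j using sym by (simp add: symmetric_mat_nth)
      have pat': "X' $ i $ j = 0" if "i \<noteq> j" "\<not> eliminate E a i j" for i j
      proof (cases "i = a \<or> j = a")
        case True
        then show ?thesis using a symE[of a j] by (auto simp: X')
      next
        case False
        then have "\<not> E i j" "\<not> E a i \<or> \<not> E a j" using that by (auto simp: eliminate_def)
        then show ?thesis
          using that pat[of i j] pat[of a i] pat[of a j] False symE[of a i] symE[of a j]
          by (auto simp: X')
      qed
      have "clique_sum (eliminate E a) X'"
      proof (rule less.hyps[OF rk simple_graph_eliminate[OF sg] _ pat'])
        show "pos_semidef X'" unfolding X'_def by (rule pos_semidef_deflate[OF psd pos])
        fix vs assume vs: "induced_cycle (eliminate E a) vs" "4 \<le> length vs"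
        obtain ws where "induced_cycle E ws" "length vs \<le> length ws" "length ws \<le> length vs + 1"
          using induced_cycle_eliminate[OF sg vs] by blast
        \<comment> \<open>The rank drops by at least one and the cycle is at most one shorter than
          one in \<open>E\<close>, so the bound persists.\<close>
        then show "rank X' + 2 < length vs" using cyc[of ws] vs(2) rk by simp
      qed
      moreover have Xb: "X' $ b $ b \<noteq> 0"
        using b pat[OF ab nE] symE[of a b] by (simp add: X')
      ultimately obtain w where w: "(X' *v w) $ b \<noteq> 0"
        "clique (eliminate E a) {j. (X' *v w) $ j \<noteq> 0}"
        using clique_sum_diagonal by blast
      \<comment> \<open>The vector is also in the range of \<open>X\<close>, where by the case
        assumption no nonzero vector has clique support in \<open>E\<close>.\<close>
      have "X' *v w = X *v (w - ((X *v ?z) \<bullet> w / (?z \<bullet> (X *v ?z))) *\<^sub>R ?z)"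
        unfolding X'_def
        by (simp add: deflate_mult_vec matrix_vector_mult_diff_distrib matrix_vector_mult_scaleR)
      then have "\<not> clique E {j. (X' *v w) $ j \<noteq> 0}"
        using False w(1) by (metis zero_index)
      moreover have "\<not> (\<exists>vs. induced_cycle E vs \<and> length vs = 4)"
      proof -
        \<comment> \<open>Hence \<open>rank X\<close> is at least 2, and the hypothesis on cycles
          excludes length 4.\<close>
        have "rank X' \<noteq> 0" using Xb by (auto simp: rank_eq_0)
        then show ?thesis using cyc rk by fastforce
      qed
      ultimately have "E a b" using clique_eliminate[OF sg _ w(2)] w(1) by blast
      with nE show False ..
    qed
    have "X $ a $ a = 0" for a
    proof (rule ccontr)
      assume a: "X $ a $ a \<noteq> 0"
      have "X $ i $ i \<noteq> 0" if "X $ i $ a \<noteq> 0" for i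
        using that pos_semidef_diagonal_zero[OF psd, of i a] sym by (auto simp: symmetric_mat_nth)
      then have "clique E {i. (X *v axis a 1) $ i \<noteq> 0}"
        using adj by (auto simp: clique_def mult_axis_nth)
      moreover have "X *v axis a 1 \<noteq> 0" using a by (metis mult_axis_nth zero_index)
      ultimately show False using False by blast
    qed
    then have "X = 0" using pos_semidef_diagonal_zero[OF psd] by (simp add: vec_eq_iff)
    then show ?thesis by (simp add: clique_sum.zero)
  qed
qed

section \<open>Positive definite completions\<close>

lemma affine_bounded_imp_slope_zero:
  fixes p q b :: real
  assumes "\<And>t. p + t * q \<le> b"
  shows "q = 0"
proof (rule ccontr)
  assume "q \<noteq> 0"
  then show False using assms[of "(b - p + 1) / q"] by simp
qed

lemma unit_mult_vec: "axis i (axis j 1) *v x = x $ j *\<^sub>R axis i 1" for x :: "real^'n"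
proof -
  have "(axis i (axis j 1) *v x) $ k = (x $ j *\<^sub>R axis i 1) $ k" for k
    using inner_axis'[of j 1 x] by (simp add: matrix_vector_mul_component axis_def[of i])
  then show ?thesis by (simp add: vec_eq_iff)
qed

lemma inner_unit: "Y \<bullet> axis i (axis j 1) = Y $ i $ j" for Y :: "real^'n^'m"
  by (simp add: inner_axis)

text \<open>The separation is carried out among all matrices, not only the symmetric ones: a hyperplane
  separating two sets of symmetric matrices could have an antisymmetric normal.\<close>

lemma no_pos_def_completion_certificate:
  fixes A :: "real^'n^'n"
  assumes sg: "simple_graph E" and symA: "symmetric_mat A"
    and no: "\<not> (\<exists>B. completion E A B \<and> pos_def B)"
  obtains Y where "Y \<noteq> 0" "pos_semidef Y" "\<And>i j. i \<noteq> j \<Longrightarrow> \<not> E i j \<Longrightarrow> Y $ i $ j = 0" "Y \<bullet> A \<le> 0"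
proof -
  define S where "S = {C :: real^'n^'n. (\<forall>i. C $ i $ i = A $ i $ i) \<and> (\<forall>i j. E i j \<longrightarrow> C $ i $ j = A $ i $ j)}"
  define T where "T = {C :: real^'n^'n. \<forall>x. x \<noteq> 0 \<longrightarrow> x \<bullet> (C *v x) > 0}"
  have "convex S"
    by (rule convexI) (auto simp: S_def simp flip: distrib_right)
  moreover have "convex T"
  proof (rule convexI)
    fix C D :: "real^'n^'n" and u v :: real
    assume CD: "C \<in> T" "D \<in> T" and uv: "u \<ge> 0" "v \<ge> 0" "u + v = 1"
    have "x \<bullet> ((u *\<^sub>R C + v *\<^sub>R D) *v x) > 0" if "x \<noteq> 0" for x
    proof -
      have p: "x \<bullet> (C *v x) > 0" "x \<bullet> (D *v x) > 0" using CD that by (auto simp: T_def)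
      have "u * (x \<bullet> (C *v x)) + v * (x \<bullet> (D *v x)) > 0"
      proof (cases "u = 0")
        case True
        then show ?thesis using p uv by simp
      next
        case False
        then have "u * (x \<bullet> (C *v x)) > 0" using p uv by simp
        moreover have "v * (x \<bullet> (D *v x)) \<ge> 0" using p uv by simp
        ultimately show ?thesis by linarith
      qed
      then show ?thesis
        by (simp add: matrix_vector_mult_add_rdistrib inner_add_right scaleR_matrix_vector_assoc[symmetric])
    qed
    then show "u *\<^sub>R C + v *\<^sub>R D \<in> T" by (simp add: T_def)
  qed
  moreover have AS: "A \<in> S" by (simp add: S_def)
  moreover have IT: "mat 1 \<in> T" by (simp add: T_def)
  moreover have "S \<inter> T = {}"
  proof (rule ccontr)
    assume "S \<inter> T \<noteq> {}"
    then obtain C where C: "C \<in> S" "C \<in> T" by blast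
    \<comment> \<open>Symmetrising keeps the quadratic form, and keeps the specified entries since
      \<open>A\<close> and \<open>E\<close> are symmetric.\<close>
    define B where "B = (1/2) *\<^sub>R (C + transpose C)"
    have Bn: "B $ i $ j = (C $ i $ j + C $ j $ i) / 2" for i j
      by (simp add: B_def transpose_def)
    have sB: "symmetric_mat B" by (simp add: symmetric_mat_nth Bn)
    have "completion E A B"
      using sB C(1) symA sg
      by (auto simp: completion_def Bn S_def symmetric_mat_nth simple_graph_def)
    moreover have "x \<bullet> (B *v x) = x \<bullet> (C *v x)" for x
    proof -
      have "x \<bullet> (transpose C *v x) = x \<bullet> (C *v x)"
        by (metis dot_lmul_matrix inner_commute transpose_matrix_vector)
      then show ?thesis
        by (simp add: B_def matrix_vector_mult_add_rdistrib inner_add_right scaleR_matrix_vector_assoc[symmetric])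
    qed
    then have "pos_def B" using sB C(2) by (simp add: pos_def_def T_def)
    ultimately show False using no by blast
  qed
  ultimately obtain Y b where Y: "Y \<noteq> 0" and YS: "\<And>C. C \<in> S \<Longrightarrow> Y \<bullet> C \<le> b"
    and YT: "\<And>C. C \<in> T \<Longrightarrow> Y \<bullet> C \<ge> b"
    using separating_hyperplane_sets[of S T] by blast
  have scale: "s *\<^sub>R C \<in> T" if "C \<in> T" "s > 0" for C s
    using that by (simp add: T_def scaleR_matrix_vector_assoc[symmetric])
  \<comment> \<open>\<open>T\<close> is a cone: scaling up makes any negative value fall below
    \<open>b\<close>, and scaling \<open>mat 1\<close> towards 0 shows
    \<open>b \<le> 0\<close>.\<close>
  have T0: "Y \<bullet> C \<ge> 0" if "C \<in> T" for C
  proof (rule ccontr)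
    assume neg: "\<not> Y \<bullet> C \<ge> 0"
    define s where "s = (\<bar>b\<bar> + 1) / (- (Y \<bullet> C))"
    have s: "s > 0" using neg by (simp add: s_def divide_pos_pos divide_pos_neg)
    have "s * (Y \<bullet> C) = - (\<bar>b\<bar> + 1)" using neg by (simp add: s_def)
    then show False using YT[OF scale[OF that s]] by simp
  qed
  have b0: "b \<le> 0"
  proof (rule ccontr)
    assume b: "\<not> b \<le> 0"
    then have p: "Y \<bullet> mat 1 > 0" using YT[OF IT] by simp
    define s where "s = b / (2 * (Y \<bullet> mat 1))"
    have s: "s > 0" using b p by (simp add: s_def)
    have "s * (Y \<bullet> mat 1) = b / 2" using p by (simp add: s_def)
    then show False using YT[OF scale[OF IT s]] b by simp
  qed
  have pat: "Y $ i $ j = 0" if "i \<noteq> j" "\<not> E i j" for i j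
  proof (rule affine_bounded_imp_slope_zero)
    fix t
    \<comment> \<open>An unspecified entry can move freely within \<open>S\<close>, so a functional
      bounded above on \<open>S\<close> has zero coefficient there.\<close>
    have "A + t *\<^sub>R axis i (axis j 1) \<in> S"
      using that by (auto simp: S_def axis_def)
    from YS[OF this] show "Y \<bullet> A + t * Y $ i $ j \<le> b"
      by (simp add: inner_add_right inner_unit)
  qed
  have "Y $ i $ j = Y $ j $ i" for i j
  proof -
    have "Y $ j $ i - Y $ i $ j = 0"
    proof (rule affine_bounded_imp_slope_zero)
      fix t
      \<comment> \<open>An antisymmetric perturbation does not change the quadratic form, so the
        whole line stays in \<open>T\<close>; this makes \<open>Y\<close> symmetric.\<close>
      have "x \<bullet> ((mat 1 + t *\<^sub>R (axis i (axis j 1) - axis j (axis i 1))) *v x) = x \<bullet> x" for x :: "real^'n"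
        by (simp add: matrix_vector_mult_add_rdistrib inner_add_right matrix_vector_mult_diff_rdistrib
            scaleR_matrix_vector_assoc[symmetric] unit_mult_vec inner_diff_right inner_axis)
      then have "mat 1 + t *\<^sub>R (axis i (axis j 1) - axis j (axis i 1)) \<in> T"
        by (simp add: T_def)
      from T0[OF this] show "- (Y \<bullet> mat 1) + t * (Y $ j $ i - Y $ i $ j) \<le> 0"
        by (simp add: inner_add_right inner_diff_right inner_unit algebra_simps)
    qed
    then show ?thesis by simp
  qed
  moreover have "x \<bullet> (Y *v x) \<ge> 0" for x
  proof (rule ccontr)
    assume neg: "\<not> x \<bullet> (Y *v x) \<ge> 0"
    define p where "p = Y \<bullet> mat 1"
    \<comment> \<open>\<open>outer x\<close> may lie only on the boundary of \<open>T\<close>, so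
      \<open>s\<close> times the identity is added. This \<open>s\<close> makes the pairing with
      \<open>Y\<close> equal to \<open>- s\<close>, which is negative.\<close>
    define s where "s = - (x \<bullet> (Y *v x)) / (p + 1)"
    have p: "p \<ge> 0" using T0[OF IT] by (simp add: p_def)
    have s: "s > 0" using neg p by (simp add: s_def divide_pos_pos divide_neg_pos)
    have "z \<bullet> ((outer x + s *\<^sub>R mat 1) *v z) > 0" if "z \<noteq> 0" for z
    proof -
      have "z \<bullet> ((outer x + s *\<^sub>R mat 1) *v z) = (x \<bullet> z)^2 + s * (z \<bullet> z)"
        by (simp add: matrix_vector_mult_add_rdistrib inner_add_right outer_mult_vec
            scaleR_matrix_vector_assoc[symmetric] power2_eq_square inner_commute)
      moreover have "s * (z \<bullet> z) > 0" using s that by simp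
      ultimately show ?thesis using zero_le_power2[of "x \<bullet> z"] by linarith
    qed
    then have "outer x + s *\<^sub>R mat 1 \<in> T" by (simp add: T_def)
    from T0[OF this] have "0 \<le> x \<bullet> (Y *v x) + s * p"
      by (simp add: inner_add_right p_def inner_commute[of Y "outer x"] inner_outer)
    moreover have "s * (p + 1) = - (x \<bullet> (Y *v x))" using p by (simp add: s_def)
    ultimately show False using s by (simp add: algebra_simps)
  qed
  ultimately have "pos_semidef Y" by (simp add: pos_semidef_def symmetric_mat_nth)
  moreover have "Y \<bullet> A \<le> 0" using YS[OF AS] b0 by simp
  ultimately show thesis using that Y pat by blast
qed

section \<open>Pairing sums of squares with a second matrix\<close>

lemma clique_sum_inner_pos:
  assumes "clique_sum E X" "\<And>C. clique E C \<Longrightarrow> principal_submatrix_pos_def A C"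
  shows "X = 0 \<or> X \<bullet> A > 0"
  using assms(1)
proof (induction rule: clique_sum.induct)
  case zero
  then show ?case by simp
next
  case (add X y)
  show ?case
  proof (cases "y = 0")
    case True
    then show ?thesis using add by simp
  next
    case False
    then have "y \<bullet> (A *v y) > 0"
      using assms(2)[OF add.hyps(2)] by (auto simp: principal_submatrix_pos_def_def)
    then show ?thesis using add.IH by (auto simp: inner_add_left inner_outer)
  qed
qed

text \<open>The pairing is a sum of nonnegative terms \<open>y \<bullet> (B *v y)\<close>. If it is
  zero, each term is, and then \<open>B\<close> kills each \<open>y\<close> and so the range of
  \<open>X\<close>.\<close>

lemma clique_sum_inner_pos_semidef:
  assumes "clique_sum E X" "pos_semidef B"
  shows "X \<bullet> B \<ge> 0 \<and> (X \<bullet> B = 0 \<longrightarrow> (\<forall>x. B *v (X *v x) = 0))"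
  using assms(1)
proof (induction rule: clique_sum.induct)
  case zero
  then show ?case by simp
next
  case (add X y)
  have y: "y \<bullet> (B *v y) \<ge> 0" by (rule pos_semidefD(2)[OF assms(2)])
  have "B *v ((X + outer y) *v x) = 0" if "(X + outer y) \<bullet> B = 0" for x
  proof -
    have "X \<bullet> B = 0" "y \<bullet> (B *v y) = 0"
      using that y add.IH by (auto simp: inner_add_left inner_outer)
    then show ?thesis using add.IH pos_semidef_kernel[OF assms(2), of y]
      by (simp add: matrix_vector_mult_add_rdistrib matrix_vector_right_distrib outer_mult_vec
          matrix_vector_mult_scaleR)
  qed
  then show ?case using y add.IH by (auto simp: inner_add_left inner_outer)
qed

text \<open>In the complete graph every set is a clique and no long induced cycle exists, so the
  sparse decomposition writes any positive semidefinite \<open>X\<close> as a sum of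
  squares.\<close>

lemma pos_semidef_inner_nonneg:
  fixes X B :: "real^'n^'n"
  assumes "pos_semidef X" "pos_semidef B"
  shows "X \<bullet> B \<ge> 0" and "X \<bullet> B = 0 \<Longrightarrow> B *v (X *v x) = 0"
proof -
  have "clique_sum (\<noteq>) X"
  proof (rule sparse_pos_semidef_clique_sum)
    show "simple_graph ((\<noteq>) :: 'n \<Rightarrow> _)" by (auto simp: simple_graph_def)
    fix vs :: "'n list"
    assume vs: "induced_cycle (\<noteq>) vs" "4 \<le> length vs"
    then have len: "0 < length vs" "2 < length vs" by linarith+
    \<comment> \<open>Positions 0 and 2 carry distinct, hence adjacent, vertices, but are not
      consecutive once the length is at least 4.\<close>
    then have "vs ! 0 \<noteq> vs ! 2"
      using vs(1) nth_eq_iff_index_eq[of vs 0 2] by (auto simp: induced_cycle_def)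
    with len have "2 = (0 + 1) mod length vs \<or> 0 = (2 + 1) mod length vs"
      using vs(1) unfolding induced_cycle_def by blast
    then show "rank X + 2 < length vs" using vs(2) by auto
  qed (use assms in auto)
  from clique_sum_inner_pos_semidef[OF this assms(2)]
  show "X \<bullet> B \<ge> 0" and "X \<bullet> B = 0 \<Longrightarrow> B *v (X *v x) = 0" by auto
qed

lemma inner_completion:
  fixes A :: "real^'n^'n"
  assumes "completion E A B" "\<And>i j. i \<noteq> j \<Longrightarrow> \<not> E i j \<Longrightarrow> Y $ i $ j = 0"
  shows "Y \<bullet> B = Y \<bullet> A"
proof -
  have "Y $ i $ j * B $ i $ j = Y $ i $ j * A $ i $ j" for i j
    using assms by (cases "i = j"; cases "E i j") (auto simp: completion_def)
  then show ?thesis unfolding inner_vec_def inner_real_def by (simp only:)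
qed

text \<open>For clique-supported \<open>x\<close> the form involves only specified entries, on which
  \<open>A\<close> and \<open>B\<close> agree.\<close>

lemma pos_def_completion_imp_principal_submatrix_pos_def:
  fixes A :: "real^'n^'n"
  assumes symA: "symmetric_mat A" and B: "completion E A B" "pos_def B" and C: "clique E C"
  shows "principal_submatrix_pos_def A C"
proof -
  have "x \<bullet> (A *v x) > 0" if x: "x \<noteq> 0" "\<forall>i. i \<notin> C \<longrightarrow> x $ i = 0" for x
  proof -
    have "outer x $ i $ j = 0" if "i \<noteq> j" "\<not> E i j" for i j
      using C x(2) that by (auto simp: clique_def)
    then have "x \<bullet> (A *v x) = x \<bullet> (B *v x)"
      using inner_completion[OF B(1), of "outer x"] by (simp add: inner_outer)
    then show ?thesis using B(2) x(1) by (simp add: pos_def_def)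
  qed
  then show ?thesis using symA by (auto simp: principal_submatrix_pos_def_def symmetric_mat_nth)
qed

lemma rank_pos_def: "pos_def B \<Longrightarrow> rank B = CARD('n)" for B :: "real^'n^'n"
  using matrix_nonfull_linear_equations_eq[of B]
  by (metis inner_zero_right less_irrefl pos_def_def)

lemma min_long_induced_cycle:
  assumes "\<not> chordal E"
  shows "4 \<le> min_long_induced_cycle E"
  using assms LeastI_ex[of "\<lambda>k. \<exists>vs. induced_cycle E vs \<and> length vs = k \<and> k \<ge> 4"]
  unfolding chordal_def min_long_induced_cycle_def by blast

lemma min_long_induced_cycle_le:
  "induced_cycle E vs \<Longrightarrow> 4 \<le> length vs \<Longrightarrow> min_long_induced_cycle E \<le> length vs"
  unfolding min_long_induced_cycle_def by (rule Least_le) blast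

theorem theorem6p7:
  fixes E :: "'n::finite \<Rightarrow> 'n \<Rightarrow> bool" and A :: "real^'n^'n"
  assumes "simple_graph E" and "symmetric_mat A"
  shows "(\<not> chordal E \<longrightarrow>
            ((\<exists>B. completion E A B \<and> pos_def B) \<longleftrightarrow>
             ((\<forall>C. clique E C \<longrightarrow> principal_submatrix_pos_def A C) \<and>
              (\<exists>B. completion E A B \<and> pos_semidef B \<and>
                   int (rank B) > int CARD('n) - int (min_long_induced_cycle E) + 2))))
       \<and> (chordal E \<longrightarrow>
            ((\<exists>B. completion E A B \<and> pos_def B) \<longleftrightarrow>
             (\<forall>C. clique E C \<longrightarrow> principal_submatrix_pos_def A C)))"
proof -
  let ?a = "\<forall>C. clique E C \<longrightarrow> principal_submatrix_pos_def A C"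
  let ?m = "min_long_induced_cycle E"
  let ?b = "\<exists>B. completion E A B \<and> pos_semidef B \<and> int (rank B) > int CARD('n) - int ?m + 2"
  let ?pd = "\<exists>B. completion E A B \<and> pos_def B"
  have a: ?a if ?pd
    using that pos_def_completion_imp_principal_submatrix_pos_def[OF assms(2)] by blast
  have b: ?b if nc: "\<not> chordal E" and ex: ?pd
  proof -
    obtain B where B: "completion E A B" "pos_def B" using ex by blast
    have "pos_semidef B"
      unfolding pos_semidef_def
    proof (intro conjI allI)
      show "symmetric_mat B" using B(2) by (simp add: pos_def_def)
      show "0 \<le> x \<bullet> (B *v x)" for x using B(2) by (cases "x = 0") (auto simp: pos_def_def less_imp_le)
    qed
    \<comment> \<open>\<open>B\<close> has full rank, which exceeds the threshold because the
      minimal length is at least 4.\<close>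
    then show ?thesis using B rank_pos_def[OF B(2)] min_long_induced_cycle[OF nc] by auto
  qed
  \<comment> \<open>Shared by both cases: chordality makes \<open>short\<close> vacuous, and
    otherwise (b) supplies it.\<close>
  have pd: ?pd if a: ?a and short: "\<And>Y. pos_semidef Y \<Longrightarrow> Y \<bullet> A \<le> 0 \<Longrightarrow>
      (\<And>i j. i \<noteq> j \<Longrightarrow> \<not> E i j \<Longrightarrow> Y $ i $ j = 0) \<Longrightarrow>
      \<forall>vs. induced_cycle E vs \<longrightarrow> 4 \<le> length vs \<longrightarrow> rank Y + 2 < length vs"
  proof (rule ccontr)
    assume "\<not> ?pd"
    then obtain Y where Y: "Y \<noteq> 0" "pos_semidef Y"
      "\<And>i j. i \<noteq> j \<Longrightarrow> \<not> E i j \<Longrightarrow> Y $ i $ j = 0" "Y \<bullet> A \<le> 0"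
      using no_pos_def_completion_certificate[OF assms] by metis
    have "clique_sum E Y"
      using short[OF Y(2,4,3)] by (intro sparse_pos_semidef_clique_sum[OF assms(1) Y(2,3)]) auto
    then show False using clique_sum_inner_pos[of E Y A] a Y by auto
  qed
  have "?pd" if a: ?a and b: ?b
  proof (rule pd[OF a])
    fix Y :: "real^'n^'n"
    assume Y: "pos_semidef Y" "Y \<bullet> A \<le> 0" "\<And>i j. i \<noteq> j \<Longrightarrow> \<not> E i j \<Longrightarrow> Y $ i $ j = 0"
    obtain B where B: "completion E A B" "pos_semidef B" "int (rank B) > int CARD('n) - int ?m + 2"
      using b by blast
    \<comment> \<open>The pairing equals \<open>Y \<bullet> A \<le> 0\<close>, yet two positive
      semidefinite matrices pair nonnegatively.\<close>
    have "Y \<bullet> B = 0"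
      using inner_completion[OF B(1), of Y] Y pos_semidef_inner_nonneg(1)[OF Y(1) B(2)] by simp
    then have "rank Y + rank B \<le> CARD('n)"
      using pos_semidef_inner_nonneg(2)[OF Y(1) B(2)] pos_semidefD(1)[OF B(2)]
      by (intro rank_add_le_of_product_zero) auto
    \<comment> \<open>Here \<open>rank Y \<le> CARD('n) - rank B < ?m - 2\<close>, and
      \<open>?m\<close> bounds every long induced cycle from below.\<close>
    then show "\<forall>vs. induced_cycle E vs \<longrightarrow> 4 \<le> length vs \<longrightarrow> rank Y + 2 < length vs"
      using B(3) min_long_induced_cycle_le[of E] by fastforce
  qed
  moreover have ?pd if "chordal E" ?a
    using that(1) by (intro pd[OF that(2)]) (auto simp: chordal_def)
  ultimately show ?thesis using a b by blast
qed

end
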